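(* Let $N\ge 3$, $2^*=\frac{2N}{N-2}$, $\Omega>0$, and let $F(s)=\frac12\Omega^2 s^2+R(s)$ for $s\in\mathbb R^+=[0,\infty)$, where $R:\mathbb R^+\to\mathbb R$ is of class $C^2$ and satisfies: $R(0)=R'(0)=R''(0)=0$; $R(s)\ge-\frac12\Omega^2s^2$ for all $s\in\mathbb R^+$; there is $s_0\in\mathbb R^+$ with $R(s_0)<0$; and $|R''(s)|\le c_1s^{p-2}+c_2s^{q-2}$ for all $s$, for some $c_1,c_2>0$ and $2<p\le q<2^*$. Then the nonlinear Klein-Gordon equation $$\psi_{tt}-\Delta\psi+F'(|\psi|)\frac{\psi}{|\psi|}=0\quad\text{on }\mathbb R\times\mathbb R^N$$ has hylomorphic solitons of charge $\sigma$ only for charges $\sigma>\sigma_g$, where $$\sigma_g=\inf\left\{\Omega K(u)-\sqrt{2K(u)|J_0(u)|}\ :\ u\in H^1(\mathbb R^N,\mathbb R^+),\ J_0(u)<0\right\}.$$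
   Context: For $u\in H^1(\mathbb R^N,\mathbb R^+)$: $J_0(u)=\int_{\mathbb R^N}[\frac12|\nabla u|^2+R(u)]dx$, $K(u)=\int_{\mathbb R^N}|u|^2dx$. On $Y=H^1(\mathbb R^N,\mathbb R^+)\times\mathbb R^+$: energy $E(u,\omega)=J_0(u)+\frac12(\Omega^2+\omega^2)K(u)$, charge $H(u,\omega)=-\omega K(u)$. For $\sigma>0$, $M_\sigma=\{(u,\omega)\in Y:\ |H(u,\omega)|=\sigma\}$. The hylomorphic ratio is $\Lambda(u,\omega)=\frac{E(u,\omega)}{|H(u,\omega)|}=\frac12\left(\omega+\frac{\Omega^2}{\omega}\right)+\frac{J_0(u)}{\omega K(u)}$. A standing wave is a finite energy solution $\psi(t,x)=u(x)e^{-i\omega t}$, $u\ge0$, of the equation, i.e. a pair $(u,\omega)\in Y$ with $-\Delta u+F'(u)=\omega^2u$; it has charge $\sigma$ if $(u,\omega)\in M_\sigma$. Let $X=H^1(\mathbb R^N,\mathbb C)\times L^2(\mathbb R^N,\mathbb C)$ and let $U:\mathbb R\times X\to X$ be the flow of the equation, $U(t,(\psi(0),\psi_t(0)))=(\psi(t),\psi_t(t))$. The standing wave is orbitally stable if the set $\Gamma=\{(u(\cdot+y)e^{i\theta},-i\omega u(\cdot+y)e^{i\theta}):y\in\mathbb R^N,\theta\in\mathbb R\}\subset X$ is Lyapunov stable: for every $\varepsilon>0$ there is $\delta>0$ such that $d_X(\Psi,\Gamma)<\delta$ implies $d_X(U(t,\Psi),\Gamma)<\varepsilon$ for all $t\in\mathbb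 R$. A soliton is an orbitally stable standing wave. A ground state on $M_\sigma$ is a point of global minimum of $E$ on $M_\sigma$. A soliton of charge $\sigma$ is hylomorphic if it is a ground state on $M_\sigma$ and $\inf_{M_\sigma}\Lambda<\Omega$. *)

theory Defs
  imports "HOL-Analysis.Analysis"
begin

subsection \<open>Test functions and Sobolev spaces\<close>

text \<open>Elements of \<open>L\<^sup>2\<close> and \<open>H\<^sup>1\<close> are represented by functions. Functions that agree almost
  everywhere are not identified, but all norms, distances and integrals below agree on them.\<close>

primrec C_k :: "nat \<Rightarrow> ('a::euclidean_space \<Rightarrow> real) \<Rightarrow> bool" where
  "C_k 0 f \<longleftrightarrow> continuous_on UNIV f"
| "C_k (Suc k) f \<longleftrightarrow>
     (\<forall>x. f differentiable (at x)) \<and> (\<forall>b\<in>Basis. C_k k (\<lambda>x. frechet_derivative f (at x) b))"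

definition test_function :: "('a::euclidean_space \<Rightarrow> real) \<Rightarrow> bool" where
  "test_function \<phi> \<longleftrightarrow> (\<forall>k. C_k k \<phi>) \<and> compact (closure {x. \<phi> x \<noteq> 0})"

definition L2 :: "('a::euclidean_space \<Rightarrow> 'b::euclidean_space) set" where
  "L2 = {u. u \<in> borel_measurable lebesgue \<and> integrable lebesgue (\<lambda>x. (norm (u x))\<^sup>2)}"

definition has_weak_partial ::
  "('a::euclidean_space \<Rightarrow> 'b::euclidean_space) \<Rightarrow> 'a \<Rightarrow> ('a \<Rightarrow> 'b) \<Rightarrow> bool" where
  "has_weak_partial u b v \<longleftrightarrow> (\<forall>\<phi>. test_function \<phi> \<longrightarrow>
     (LINT x|lebesgue. frechet_derivative \<phi> (at x) b *\<^sub>R u x) = - (LINT x|lebesgue. \<phi> x *\<^sub>R v x))"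

definition H1 :: "('a::euclidean_space \<Rightarrow> 'b::euclidean_space) set" where
  "H1 = {u \<in> L2. \<forall>b\<in>Basis. \<exists>v\<in>L2. has_weak_partial u b v}"

text \<open>For \<open>u \<in> H1\<close> this is determined up to a null set.\<close>
definition weak_partial ::
  "'a \<Rightarrow> ('a::euclidean_space \<Rightarrow> 'b::euclidean_space) \<Rightarrow> 'a \<Rightarrow> 'b" where
  "weak_partial b u = (SOME v. v \<in> L2 \<and> has_weak_partial u b v)"

definition grad_sq :: "('a::euclidean_space \<Rightarrow> 'b::euclidean_space) \<Rightarrow> 'a \<Rightarrow> real" where
  "grad_sq u x = (\<Sum>b\<in>Basis. (norm (weak_partial b u x))\<^sup>2)"

definition H1_nonneg :: "('a::euclidean_space \<Rightarrow> real) set" where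
  "H1_nonneg = {u \<in> H1. AE x in lebesgue. 0 \<le> u x}"

definition norm_L2 :: "('a::euclidean_space \<Rightarrow> 'b::euclidean_space) \<Rightarrow> real" where
  "norm_L2 u = sqrt (LINT x|lebesgue. (norm (u x))\<^sup>2)"

definition norm_H1 :: "('a::euclidean_space \<Rightarrow> 'b::euclidean_space) \<Rightarrow> real" where
  "norm_H1 u = sqrt (LINT x|lebesgue. (norm (u x))\<^sup>2 + grad_sq u x)"

subsection \<open>The nonlinearity\<close>

text \<open>Derivative of a function on \<open>[0,\<infinity>)\<close>, one-sided at \<open>0\<close>; values of \<open>f\<close> at negative
  arguments play no role.\<close>
definition deriv_nonneg :: "(real \<Rightarrow> real) \<Rightarrow> real \<Rightarrow> real" where
  "deriv_nonneg f s = vector_derivative f (at s within {0..})"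

definition C2_nonneg :: "(real \<Rightarrow> real) \<Rightarrow> bool" where
  "C2_nonneg f \<longleftrightarrow> f differentiable_on {0..} \<and> deriv_nonneg f differentiable_on {0..} \<and>
     continuous_on {0..} (deriv_nonneg (deriv_nonneg f))"

definition potential_F :: "real \<Rightarrow> (real \<Rightarrow> real) \<Rightarrow> real \<Rightarrow> real" where
  "potential_F \<Omega> R s = 1/2 * \<Omega>\<^sup>2 * s\<^sup>2 + R s"

text \<open>The term \<open>F'(|z|) z/|z|\<close>, which is \<open>0\<close> at \<open>z = 0\<close>.\<close>
definition nonlin :: "real \<Rightarrow> (real \<Rightarrow> real) \<Rightarrow> complex \<Rightarrow> complex" where
  "nonlin \<Omega> R z = deriv_nonneg (potential_F \<Omega> R) (norm z) *\<^sub>R (z /\<^sub>R norm z)"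

subsection \<open>Energy, charge, hylomorphic ratio\<close>

definition J0 :: "(real \<Rightarrow> real) \<Rightarrow> ('a::euclidean_space \<Rightarrow> real) \<Rightarrow> real" where
  "J0 R u = (LINT x|lebesgue. 1/2 * grad_sq u x + R (u x))"

definition K :: "('a::euclidean_space \<Rightarrow> real) \<Rightarrow> real" where
  "K u = (LINT x|lebesgue. \<bar>u x\<bar>\<^sup>2)"

definition Y_space :: "(('a::euclidean_space \<Rightarrow> real) \<times> real) set" where
  "Y_space = H1_nonneg \<times> {0..}"

definition energy :: "real \<Rightarrow> (real \<Rightarrow> real) \<Rightarrow> ('a::euclidean_space \<Rightarrow> real) \<Rightarrow> real \<Rightarrow> real" where
  "energy \<Omega> R u \<omega> = J0 R u + 1/2 * (\<Omega>\<^sup>2 + \<omega>\<^sup>2) * K u"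

definition charge :: "('a::euclidean_space \<Rightarrow> real) \<Rightarrow> real \<Rightarrow> real" where
  "charge u \<omega> = - \<omega> * K u"

definition M :: "real \<Rightarrow> (('a::euclidean_space \<Rightarrow> real) \<times> real) set" where
  "M \<sigma> = {(u, \<omega>) \<in> Y_space. \<bar>charge u \<omega>\<bar> = \<sigma>}"

definition hylo_ratio ::
  "real \<Rightarrow> (real \<Rightarrow> real) \<Rightarrow> ('a::euclidean_space \<Rightarrow> real) \<Rightarrow> real \<Rightarrow> real" where
  "hylo_ratio \<Omega> R u \<omega> = energy \<Omega> R u \<omega> / \<bar>charge u \<omega>\<bar>"

subsection \<open>The flow of the nonlinear Klein-Gordon equation\<close>

type_synonym 'a state = "('a \<Rightarrow> complex) \<times> ('a \<Rightarrow> complex)"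

definition X_space :: "('a::euclidean_space) state set" where
  "X_space = H1 \<times> L2"

definition dist_X :: "('a::euclidean_space) state \<Rightarrow> 'a state \<Rightarrow> real" where
  "dist_X \<Phi> \<Psi> = sqrt ((norm_H1 (\<lambda>x. fst \<Phi> x - fst \<Psi> x))\<^sup>2 + (norm_L2 (\<lambda>x. snd \<Phi> x - snd \<Psi> x))\<^sup>2)"

definition dist_X_set :: "('a::euclidean_space) state \<Rightarrow> 'a state set \<Rightarrow> real" where
  "dist_X_set \<Psi> \<Gamma> = (INF \<Phi>\<in>\<Gamma>. dist_X \<Psi> \<Phi>)"

text \<open>Global finite energy solutions, as curves \<open>t \<mapsto> (\<psi>(t), \<psi>\<^sub>t(t))\<close> in \<open>X\<close>:
  \<open>\<psi>\<close> is in \<open>C(\<real>, H\<^sup>1) \<inter> C\<^sup>1(\<real>, L\<^sup>2)\<close> and the equation holds in the weak sense, that is, tested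
  against each test function in the space variable.\<close>
definition nkg_solution ::
  "real \<Rightarrow> (real \<Rightarrow> real) \<Rightarrow> (real \<Rightarrow> ('a::euclidean_space) state) \<Rightarrow> bool" where
  "nkg_solution \<Omega> R S \<longleftrightarrow>
     (\<forall>t. S t \<in> X_space) \<and>
     (\<forall>t. ((\<lambda>s. dist_X (S s) (S t)) \<longlongrightarrow> 0) (at t)) \<and>
     (\<forall>t. ((\<lambda>s. norm_L2 (\<lambda>x. (fst (S s) x - fst (S t) x) /\<^sub>R (s - t) - snd (S t) x)) \<longlongrightarrow> 0) (at t)) \<and>
     (\<forall>\<phi>. test_function \<phi> \<longrightarrow> (\<forall>t.
        ((\<lambda>s. LINT x|lebesgue. \<phi> x *\<^sub>R snd (S s) x) has_vector_derivative
           - (LINT x|lebesgue. (\<Sum>b\<in>Basis. frechet_derivative \<phi> (at x) b *\<^sub>R weak_partial b (fst (S t)) x))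
           - (LINT x|lebesgue. \<phi> x *\<^sub>R nonlin \<Omega> R (fst (S t) x))) (at t)))"

text \<open>\<open>U t \<Psi> = (\<psi>(t), \<psi>\<^sub>t(t))\<close> for the solution with \<open>(\<psi>(0), \<psi>\<^sub>t(0)) = \<Psi>\<close>. When
  \<open>F \<ge> 0\<close> and the nonlinearity is energy-subcritical, the Cauchy problem is globally well-posed in
  \<open>X\<close> (Ginibre and Velo), so this solution exists and is unique up to null sets.\<close>
definition nkg_flow ::
  "real \<Rightarrow> (real \<Rightarrow> real) \<Rightarrow> real \<Rightarrow> ('a::euclidean_space) state \<Rightarrow> 'a state" where
  "nkg_flow \<Omega> R t \<Psi> = (SOME S. nkg_solution \<Omega> R S \<and> S 0 = \<Psi>) t"

subsection \<open>Hylomorphic solitons\<close>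

text \<open>The equation \<open>-\<Delta>u + F'(u) = \<omega>\<^sup>2 u\<close> is understood in the weak sense.\<close>
definition standing_wave ::
  "real \<Rightarrow> (real \<Rightarrow> real) \<Rightarrow> ('a::euclidean_space \<Rightarrow> real) \<Rightarrow> real \<Rightarrow> bool" where
  "standing_wave \<Omega> R u \<omega> \<longleftrightarrow> (u, \<omega>) \<in> Y_space \<and>
     (\<forall>\<phi>. test_function \<phi> \<longrightarrow>
        (LINT x|lebesgue. (\<Sum>b\<in>Basis. weak_partial b u x * frechet_derivative \<phi> (at x) b))
        + (LINT x|lebesgue. deriv_nonneg (potential_F \<Omega> R) (u x) * \<phi> x)
        = \<omega>\<^sup>2 * (LINT x|lebesgue. u x * \<phi> x))"

definition orbit :: "('a::euclidean_space \<Rightarrow> real) \<Rightarrow> real \<Rightarrow> 'a state set" where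
  "orbit u \<omega> = {(\<lambda>x. of_real (u (x + y)) * exp (\<i> * of_real \<theta>),
                 \<lambda>x. - \<i> * of_real \<omega> * of_real (u (x + y)) * exp (\<i> * of_real \<theta>)) | y (\<theta>::real). True}"

definition orbitally_stable ::
  "real \<Rightarrow> (real \<Rightarrow> real) \<Rightarrow> ('a::euclidean_space \<Rightarrow> real) \<Rightarrow> real \<Rightarrow> bool" where
  "orbitally_stable \<Omega> R u \<omega> \<longleftrightarrow>
     (\<forall>\<epsilon>>0. \<exists>\<delta>>0. \<forall>\<Psi>\<in>X_space. dist_X_set \<Psi> (orbit u \<omega>) < \<delta> \<longrightarrow>
        (\<forall>t. dist_X_set (nkg_flow \<Omega> R t \<Psi>) (orbit u \<omega>) < \<epsilon>))"

definition soliton ::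
  "real \<Rightarrow> (real \<Rightarrow> real) \<Rightarrow> ('a::euclidean_space \<Rightarrow> real) \<Rightarrow> real \<Rightarrow> bool" where
  "soliton \<Omega> R u \<omega> \<longleftrightarrow> standing_wave \<Omega> R u \<omega> \<and> orbitally_stable \<Omega> R u \<omega>"

definition ground_state ::
  "real \<Rightarrow> (real \<Rightarrow> real) \<Rightarrow> real \<Rightarrow> ('a::euclidean_space \<Rightarrow> real) \<Rightarrow> real \<Rightarrow> bool" where
  "ground_state \<Omega> R \<sigma> u \<omega> \<longleftrightarrow> (u, \<omega>) \<in> M \<sigma> \<and>
     (\<forall>(v, w)\<in>(M \<sigma> :: (('a \<Rightarrow> real) \<times> real) set). energy \<Omega> R u \<omega> \<le> energy \<Omega> R v w)"

definition hylomorphic_soliton ::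
  "real \<Rightarrow> (real \<Rightarrow> real) \<Rightarrow> real \<Rightarrow> ('a::euclidean_space \<Rightarrow> real) \<Rightarrow> real \<Rightarrow> bool" where
  "hylomorphic_soliton \<Omega> R \<sigma> u \<omega> \<longleftrightarrow>
     soliton \<Omega> R u \<omega> \<and> (u, \<omega>) \<in> M \<sigma> \<and> ground_state \<Omega> R \<sigma> u \<omega> \<and>
     (INF (v, w)\<in>(M \<sigma> :: (('a \<Rightarrow> real) \<times> real) set). hylo_ratio \<Omega> R v w) < \<Omega>"

end

theory Submission
  imports Defs
begin

text \<open>Completing the square, \<open>\<Lambda>(u, \<omega>) < \<Omega>\<close> says \<open>J\<^sub>0(u) < - (\<Omega> - \<omega>)\<^sup>2 K(u) / 2\<close>. Hence
  \<open>J\<^sub>0(u) < 0\<close> and \<open>\<Omega> K(u) - \<surd>(2 K(u) |J\<^sub>0(u)|) < (\<Omega> - |\<Omega> - \<omega>|) K(u) \<le> \<omega> K(u) = \<sigma>\<close>. It remains to see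
  that the infimum defining \<open>\<sigma>\<^sub>g\<close> is a genuine one: the bound \<open>R(s) \<ge> - \<Omega>\<^sup>2 s\<^sup>2 / 2\<close> gives
  \<open>|J\<^sub>0(u)| \<le> \<Omega>\<^sup>2 K(u) / 2\<close> whenever \<open>J\<^sub>0(u) < 0\<close>, so all the values are nonnegative.\<close>

lemma K_nonneg: "0 \<le> K u"
  by (simp add: K_def)

text \<open>The gradient term is nonnegative, so dropping it leaves the pointwise bound on
  \<open>R\<close>, which applies almost everywhere since \<open>u\<close> is nonnegative
  there.\<close>

lemma J0_ge:
  fixes u :: "'a::euclidean_space \<Rightarrow> real"
  assumes R: "\<And>s. s \<ge> 0 \<Longrightarrow> R s \<ge> - (1/2) * \<Omega>\<^sup>2 * s\<^sup>2" and u: "u \<in> H1_nonneg"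
  shows "J0 R u \<ge> - (1/2) * \<Omega>\<^sup>2 * K u"
proof (cases "integrable lebesgue (\<lambda>x. 1/2 * grad_sq u x + R (u x))")
  case True
  have int: "integrable lebesgue (\<lambda>x. (u x)\<^sup>2)"
    using u by (simp add: H1_nonneg_def H1_def L2_def)
  have pos: "AE x in lebesgue. 0 \<le> u x"
    using u by (simp add: H1_nonneg_def)
  have "(LINT x|lebesgue. - (1/2) * \<Omega>\<^sup>2 * (u x)\<^sup>2) \<le> J0 R u"
    unfolding J0_def
  proof (rule integral_mono_AE)
    show "integrable lebesgue (\<lambda>x. - (1/2) * \<Omega>\<^sup>2 * (u x)\<^sup>2)"
      by (intro integrable_mult_right int)
    show "AE x in lebesgue. - (1/2) * \<Omega>\<^sup>2 * (u x)\<^sup>2 \<le> 1/2 * grad_sq u x + R (u x)"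
      using pos
    proof (rule AE_mp, intro AE_I2 impI)
      fix x
      assume "0 \<le> u x"
      moreover have "0 \<le> grad_sq u x"
        by (simp add: grad_sq_def sum_nonneg)
      ultimately show "- (1/2) * \<Omega>\<^sup>2 * (u x)\<^sup>2 \<le> 1/2 * grad_sq u x + R (u x)"
        using R[of "u x"] by linarith
    qed
  qed (use True in simp)
  then show ?thesis
    by (simp only: integral_mult_right_zero K_def power2_abs)
next
  \<comment> \<open>The integral of a non-integrable function is 0 by convention, and the right-hand
    side is at most 0.\<close>
  case False
  then have "J0 R u = 0"
    by (simp add: J0_def not_integrable_integral_eq)
  then show ?thesis
    using K_nonneg[of u] by simp
qed

lemma sqrt_K_J0_le:
  fixes u :: "'a::euclidean_space \<Rightarrow> real"
  assumes R: "\<And>s. s \<ge> 0 \<Longrightarrow> R s \<ge> - (1/2) * \<Omega>\<^sup>2 * s\<^sup>2" and u: "u \<in> H1_nonneg"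
    and "J0 R u < 0" and "\<Omega> \<ge> 0"
  shows "sqrt (2 * K u * \<bar>J0 R u\<bar>) \<le> \<Omega> * K u"
proof (rule real_le_lsqrt)
  show "0 \<le> \<Omega> * K u"
    using \<open>\<Omega> \<ge> 0\<close> K_nonneg[of u] by simp
  have "2 * \<bar>J0 R u\<bar> \<le> \<Omega>\<^sup>2 * K u"
    using J0_ge[OF R u] \<open>J0 R u < 0\<close> by simp
  \<comment> \<open>Multiplying the previous bound by \<open>K u\<close> turns its right-hand side
    into a square.\<close>
  then show "2 * K u * \<bar>J0 R u\<bar> \<le> (\<Omega> * K u)\<^sup>2"
    using mult_left_mono[OF _ K_nonneg[of u], of "2 * \<bar>J0 R u\<bar>" "\<Omega>\<^sup>2 * K u"]
    by (simp only: power_mult_distrib power2_eq_square[of "K u"] mult_ac)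
qed

lemma value_less_charge:
  assumes "hylo_ratio \<Omega> R u \<omega> < \<Omega>" and "\<omega> * K u > 0"
  shows "J0 R u < 0" and "\<Omega> * K u - sqrt (2 * K u * \<bar>J0 R u\<bar>) < \<omega> * K u"
proof -
  have K: "0 < K u"
    using assms(2) K_nonneg[of u] by (cases "K u = 0") auto
  have "energy \<Omega> R u \<omega> < \<Omega> * (\<omega> * K u)"
    using assms by (simp add: hylo_ratio_def charge_def pos_divide_less_eq)
  \<comment> \<open>The difference
    \<open>energy \<Omega> R u \<omega> - \<Omega> * (\<omega> * K u)\<close> is
    \<open>J0 R u\<close> plus half of \<open>(\<Omega> - \<omega>)\<^sup>2 * K u\<close>.\<close>
  then have J: "J0 R u < - (1/2) * ((\<Omega> - \<omega>)\<^sup>2 * K u)"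
    by (simp add: energy_def power2_eq_square algebra_simps)
  moreover have "0 \<le> (\<Omega> - \<omega>)\<^sup>2 * K u"
    using K by simp
  ultimately show neg: "J0 R u < 0"
    by linarith
  have "(\<bar>\<Omega> - \<omega>\<bar> * K u)\<^sup>2 = K u * ((\<Omega> - \<omega>)\<^sup>2 * K u)"
    by (simp add: power_mult_distrib power2_eq_square)
  also have "\<dots> < K u * (2 * \<bar>J0 R u\<bar>)"
    using J neg K by (intro mult_strict_left_mono) auto
  finally have "\<bar>\<Omega> - \<omega>\<bar> * K u < sqrt (2 * K u * \<bar>J0 R u\<bar>)"
    by (intro real_less_rsqrt) (simp add: mult_ac)
  \<comment> \<open>The absolute value came from taking a root; this removes it whichever of
    \<open>\<omega>\<close> and \<open>\<Omega>\<close> is larger.\<close>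
  moreover have "(\<Omega> - \<omega>) * K u \<le> \<bar>\<Omega> - \<omega>\<bar> * K u"
    using K by (intro mult_right_mono) auto
  ultimately show "\<Omega> * K u - sqrt (2 * K u * \<bar>J0 R u\<bar>) < \<omega> * K u"
    by (simp add: algebra_simps)
qed

text \<open>On \<open>M \<sigma>\<close> the denominator of the ratio is the constant
  \<open>\<sigma>\<close>, so a minimizer of the energy also minimizes the ratio.\<close>

lemma ground_state_hylo_ratio_less:
  fixes u :: "'a::euclidean_space \<Rightarrow> real"
  assumes gs: "ground_state \<Omega> R \<sigma> u \<omega>" and "\<sigma> > 0"
    and inf: "(INF (v, w)\<in>(M \<sigma> :: (('a \<Rightarrow> real) \<times> real) set). hylo_ratio \<Omega> R v w) < c"
  shows "hylo_ratio \<Omega> R u \<omega> < c"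
proof -
  have mem: "(u, \<omega>) \<in> M \<sigma>"
    using gs by (simp add: ground_state_def)
  \<comment> \<open>\<open>M \<sigma>\<close> contains \<open>(u, \<omega>)\<close>, so it is
    nonempty and an infimum below \<open>c\<close> yields an element with ratio below
    \<open>c\<close>.\<close>
  from inf obtain v w where vw: "(v, w) \<in> (M \<sigma> :: (('a \<Rightarrow> real) \<times> real) set)"
    and less: "hylo_ratio \<Omega> R v w < c"
    using mem by (auto dest!: cInf_lessD[rotated])
  have "energy \<Omega> R u \<omega> \<le> energy \<Omega> R v w"
    using gs vw by (auto simp: ground_state_def)
  then have "hylo_ratio \<Omega> R u \<omega> \<le> hylo_ratio \<Omega> R v w"
    using mem vw \<open>\<sigma> > 0\<close> by (simp add: hylo_ratio_def M_def divide_right_mono)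
  with less show ?thesis
    by simp
qed

theorem proposition2p4:
  fixes \<Omega> c\<^sub>1 c\<^sub>2 p q s\<^sub>0 \<sigma> :: real
    and R :: "real \<Rightarrow> real"
  assumes "CARD('n::finite) \<ge> 3"
    and "\<Omega> > 0"
    and "C2_nonneg R"
    and "R 0 = 0" and "deriv_nonneg R 0 = 0" and "deriv_nonneg (deriv_nonneg R) 0 = 0"
    and "\<And>s. s \<ge> 0 \<Longrightarrow> R s \<ge> - (1/2) * \<Omega>\<^sup>2 * s\<^sup>2"
    and "s\<^sub>0 \<ge> 0" and "R s\<^sub>0 < 0"
    and "c\<^sub>1 > 0" and "c\<^sub>2 > 0"
    and "2 < p" and "p \<le> q" and "q < 2 * real CARD('n) / (real CARD('n) - 2)"
    and "\<And>s. s \<ge> 0 \<Longrightarrow>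
           \<bar>deriv_nonneg (deriv_nonneg R) s\<bar> \<le> c\<^sub>1 * s powr (p - 2) + c\<^sub>2 * s powr (q - 2)"
    and "\<sigma> > 0"
    and "\<exists>(u :: real^'n \<Rightarrow> real) \<omega>. hylomorphic_soliton \<Omega> R \<sigma> u \<omega>"
  shows "\<sigma> > Inf {\<Omega> * K u - sqrt (2 * K u * \<bar>J0 R u\<bar>) | u :: real^'n \<Rightarrow> real.
                    u \<in> H1_nonneg \<and> J0 R u < 0}"
proof -
  from assms(17) obtain u :: "real^'n \<Rightarrow> real" and \<omega> where u: "hylomorphic_soliton \<Omega> R \<sigma> u \<omega>"
    by blast
  then have mem: "(u, \<omega>) \<in> M \<sigma>" and ratio: "hylo_ratio \<Omega> R u \<omega> < \<Omega>"
    using ground_state_hylo_ratio_less[of \<Omega> R \<sigma> u \<omega> \<Omega>] \<open>\<sigma> > 0\<close>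
    by (auto simp: hylomorphic_soliton_def)
  \<comment> \<open>Membership in \<open>Y_space\<close> gives \<open>\<omega> \<ge> 0\<close>,
    which fixes the sign when the absolute value of the charge is resolved.\<close>
  then have H1: "u \<in> H1_nonneg" and \<sigma>: "\<sigma> = \<omega> * K u"
    using K_nonneg[of u] by (auto simp: M_def Y_space_def charge_def)
  have J: "J0 R u < 0" and less: "\<Omega> * K u - sqrt (2 * K u * \<bar>J0 R u\<bar>) < \<sigma>"
    using value_less_charge[OF ratio] \<sigma> \<open>\<sigma> > 0\<close> by simp_all
  let ?S = "{\<Omega> * K u - sqrt (2 * K u * \<bar>J0 R u\<bar>) | u :: real^'n \<Rightarrow> real. u \<in> H1_nonneg \<and> J0 R u < 0}"
  have "bdd_below ?S"
  proof (rule bdd_belowI)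
    fix y
    assume "y \<in> ?S"
    then obtain v :: "real^'n \<Rightarrow> real" where "v \<in> H1_nonneg" "J0 R v < 0"
      and "y = \<Omega> * K v - sqrt (2 * K v * \<bar>J0 R v\<bar>)"
      by blast
    with sqrt_K_J0_le[OF assms(7), of v] \<open>\<Omega> > 0\<close> show "0 \<le> y"
      by linarith
  qed
  \<comment> \<open>The soliton profile \<open>u\<close> is itself a competitor; the strict
    inequality comes from its own value lying below \<open>\<sigma>\<close>.\<close>
  then have "Inf ?S \<le> \<Omega> * K u - sqrt (2 * K u * \<bar>J0 R u\<bar>)"
    using H1 J by (intro cInf_lower) blast+
  with less show ?thesis
    by simp
qed

end
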